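(* Let $n>3$ be odd. The class $\langle L_n\cup I\rangle$ does not contain any Moufang neutrosophic loop; that is, for every positive integer $m<n$ with $\gcd(m,n)=\gcd(m-1,n)=1$, $\langle L_n(m)\cup I\rangle$ is not a Moufang neutrosophic loop.
   Context: For $n>3$ odd and $m<n$ a positive integer with $\gcd(m,n)=\gcd(m-1,n)=1$, the loop $L_n(m)$ is the set $\{e,1,2,\dots,n\}$ with operation: $e\cdot i=i\cdot e=i$ for all $i$; $i\cdot i=e$ for all $i$; and for $i,j\in\{1,\dots,n\}$, $i\neq j$, $i\cdot j$ is the element $s\in\{1,\dots,n\}$ with $s\equiv mj-(m-1)i \pmod n$. The neutrosophic loop $\langle L_n(m)\cup I\rangle$ is the set $\{e,1,\dots,n,eI,1I,\dots,nI\}$ of $2(n+1)$ distinct symbols, with the product of $L_n(m)$ on $\{e,1,\dots,n\}$ and $x\cdot(yI)=(xI)\cdot y=(xI)\cdot(yI)=(x\cdot y)I$ for $x,y\in L_n(m)$. $\langle L_n\cup I\rangle$ denotes the collection of all such $\langle L_n(m)\cup I\rangle$ for fixed $n$. A neutrosophic loop is Moufang if it satisfies any one of the following identities for all its elements $x,y,z$: (i) $(xy)(zx)=(x(yz))x$; (ii) $((xy)z)y=x(y(zy))$; (iii) $x(y(xz))=((xy)x)z$. *)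

theory Defs
  imports "HOL-Algebra.Group" "HOL-Number_Theory.Cong"
begin

datatype loop_elem = E | Num nat

(* Defined for arbitrary naturals i, j; only the values on {1..n} matter, where the
   representative exists and is unique (see Ln_index_ex1). *)
definition Ln_index :: "nat \<Rightarrow> nat \<Rightarrow> nat \<Rightarrow> nat \<Rightarrow> nat" where
  "Ln_index n m i j =
     (THE s. s \<in> {1..n} \<and> [int s = int m * int j - (int m - 1) * int i] (mod int n))"

fun Ln_mult :: "nat \<Rightarrow> nat \<Rightarrow> loop_elem \<Rightarrow> loop_elem \<Rightarrow> loop_elem" where
  "Ln_mult n m E y = y"
| "Ln_mult n m x E = x"
| "Ln_mult n m (Num i) (Num j) = (if i = j then E else Num (Ln_index n m i j))"

(* HOL-Algebra's record type of carrier, product and distinguished element is used only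
   as a signature: these structures are not associative in general. *)
definition Ln :: "nat \<Rightarrow> nat \<Rightarrow> loop_elem monoid" where
  "Ln n m = \<lparr>carrier = insert E (Num ` {1..n}), monoid.mult = Ln_mult n m, one = E\<rparr>"

(* Pure x stands for x, and Indet x for the symbol xI. *)
datatype 'a neutro = Pure 'a | Indet 'a

fun neutro_mult :: "('a \<Rightarrow> 'a \<Rightarrow> 'a) \<Rightarrow> 'a neutro \<Rightarrow> 'a neutro \<Rightarrow> 'a neutro" where
  "neutro_mult f (Pure x) (Pure y) = Pure (f x y)"
| "neutro_mult f (Pure x) (Indet y) = Indet (f x y)"
| "neutro_mult f (Indet x) (Pure y) = Indet (f x y)"
| "neutro_mult f (Indet x) (Indet y) = Indet (f x y)"

definition neutrosophic :: "'a monoid \<Rightarrow> 'a neutro monoid" where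
  "neutrosophic L =
     \<lparr>carrier = Pure ` carrier L \<union> Indet ` carrier L,
      monoid.mult = neutro_mult (monoid.mult L),
      one = Pure (one L)\<rparr>"

definition neutrosophic_Ln_class :: "nat \<Rightarrow> loop_elem neutro monoid set" where
  "neutrosophic_Ln_class n =
     {neutrosophic (Ln n m) | m. 0 < m \<and> m < n \<and> gcd m n = 1 \<and> gcd (m - 1) n = 1}"

definition moufang :: "'a monoid \<Rightarrow> bool" where
  "moufang L \<longleftrightarrow>
     (\<forall>x\<in>carrier L. \<forall>y\<in>carrier L. \<forall>z\<in>carrier L.
        (x \<otimes>\<^bsub>L\<^esub> y) \<otimes>\<^bsub>L\<^esub> (z \<otimes>\<^bsub>L\<^esub> x) = (x \<otimes>\<^bsub>L\<^esub> (y \<otimes>\<^bsub>L\<^esub> z)) \<otimes>\<^bsub>L\<^esub> x)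
   \<or> (\<forall>x\<in>carrier L. \<forall>y\<in>carrier L. \<forall>z\<in>carrier L.
        ((x \<otimes>\<^bsub>L\<^esub> y) \<otimes>\<^bsub>L\<^esub> z) \<otimes>\<^bsub>L\<^esub> y = x \<otimes>\<^bsub>L\<^esub> (y \<otimes>\<^bsub>L\<^esub> (z \<otimes>\<^bsub>L\<^esub> y)))
   \<or> (\<forall>x\<in>carrier L. \<forall>y\<in>carrier L. \<forall>z\<in>carrier L.
        x \<otimes>\<^bsub>L\<^esub> (y \<otimes>\<^bsub>L\<^esub> (x \<otimes>\<^bsub>L\<^esub> z)) = ((x \<otimes>\<^bsub>L\<^esub> y) \<otimes>\<^bsub>L\<^esub> x) \<otimes>\<^bsub>L\<^esub> z)"

lemma Ln_index_ex1:
  assumes "0 < n"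
  shows "\<exists>!s. s \<in> {1..n} \<and> [int s = int m * int j - (int m - 1) * int i] (mod int n)"
proof -
  define a where "a = int m * int j - (int m - 1) * int i"
  define s where "s = nat ((a - 1) mod int n + 1)"
  have b: "0 \<le> (a - 1) mod int n" "(a - 1) mod int n < int n"
    using assms by simp_all
  have s: "int s = (a - 1) mod int n + 1"
    using b by (simp add: s_def)
  have "s \<in> {1..n}"
    using s b by auto
  moreover have "[int s = a] (mod int n)"
    unfolding s cong_def by (simp add: mod_add_left_eq)
  moreover have "t = s" if "t \<in> {1..n}" "[int t = a] (mod int n)" for t
  proof -
    have "[int t - 1 = a - 1] (mod int n)"
      using that(2) by (intro cong_diff) simp_all
    moreover have "(int t - 1) mod int n = int t - 1"
      using that(1) by (intro mod_pos_pos_trivial) auto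
    ultimately show ?thesis
      using s by (simp add: cong_def)
  qed
  ultimately show ?thesis
    unfolding a_def[symmetric] by blast
qed

end

theory Submission imports Defs begin

text \<open>
  The pure elements form a copy of \<open>L\<^sub>n(m)\<close> inside the neutrosophic loop, so it is enough to
  refute the Moufang identities in \<open>L\<^sub>n(m)\<close>. There every element squares to \<open>e\<close>, and distinct
  residues \<open>a\<close>, \<open>b\<close> modulo \<open>n\<close> multiply by the affine rule \<open>a b = a + m (b - a)\<close>, so that
  \<open>0 a = m a\<close> and \<open>a 0 = (1 - m) a\<close>. Specialising a Moufang identity by repeating variables or
  inserting \<open>e\<close> and using \<open>x x = e\<close> gives laws in two variables. Evaluated at \<open>x = 0\<close> and
  \<open>y = 1\<close>, they become congruences for \<open>m\<close> modulo \<open>n\<close>: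

  \<^item> (i) gives \<open>m = 1 - m\<close> from \<open>x y = y x\<close>, and \<open>(1 - m)\<^sup>2 = 1\<close> from \<open>(x (y x)) x = x y\<close>;
  \<^item> (ii) gives \<open>(1 - m)\<^sup>2 = 1\<close> from \<open>(y x) x = y\<close>, and \<open>m (1 - m) = 1\<close> from \<open>x (y x) = y\<close>;
  \<^item> (iii) gives \<open>m\<^sup>2 = 1\<close> from \<open>x (x y) = y\<close>, and \<open>(1 - m) m = 1\<close> from \<open>(x y) x = y\<close>.

  Since \<open>m\<close> and \<open>1 - m\<close> are units modulo \<open>n\<close>, each pair of congruences forces \<open>n\<close> to divide \<open>3\<close>,
  which is impossible for \<open>n > 3\<close>.
\<close>

text \<open>
  The residue class of \<open>a\<close> as a loop element: its representative lies in \<open>{1..n}\<close>, so residue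
  \<open>0\<close> is the element \<open>n\<close>.
\<close>

definition Residue :: "nat \<Rightarrow> int \<Rightarrow> loop_elem" where
  "Residue n a = Num (nat ((a - 1) mod int n + 1))"

lemma Residue_in_carrier:
  assumes "0 < n"
  shows "Residue n a \<in> carrier (Ln n m)"
proof -
  have "0 \<le> (a - 1) mod int n" "(a - 1) mod int n < int n"
    using assms by simp_all
  then have "nat ((a - 1) mod int n + 1) \<in> {1..n}" by auto
  then show ?thesis by (auto simp: Residue_def Ln_def)
qed

lemma Residue_eq_iff:
  assumes "0 < n"
  shows "Residue n a = Residue n b \<longleftrightarrow> int n dvd a - b"
proof -
  have "0 \<le> (a - 1) mod int n" "0 \<le> (b - 1) mod int n"
    using assms by simp_all
  then have "Residue n a = Residue n b \<longleftrightarrow> (a - 1) mod int n = (b - 1) mod int n"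
    unfolding Residue_def by auto
  also have "\<dots> \<longleftrightarrow> int n dvd a - b"
    by (simp add: mod_eq_dvd_iff)
  finally show ?thesis .
qed

lemma Ln_mult_Residue:
  assumes "0 < n" and "\<not> int n dvd a - b"
  shows "Ln_mult n m (Residue n a) (Residue n b) = Residue n (a + int m * (b - a))"
proof -
  define rep where "rep c = nat ((c - 1) mod int n + 1)" for c
  have rep: "rep c \<in> {1..n}" "[int (rep c) = c] (mod int n)" for c
  proof -
    have b: "0 \<le> (c - 1) mod int n" "(c - 1) mod int n < int n"
      using assms(1) by simp_all
    then show "rep c \<in> {1..n}" by (auto simp: rep_def)
    have "int (rep c) = (c - 1) mod int n + 1" using b by (simp add: rep_def)
    then show "[int (rep c) = c] (mod int n)" by (simp add: cong_def mod_add_left_eq)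
  qed
  have "[int m * int (rep b) - (int m - 1) * int (rep a) = int m * b - (int m - 1) * a] (mod int n)"
    by (intro cong_diff cong_mult rep(2) cong_refl)
  also have "int m * b - (int m - 1) * a = a + int m * (b - a)"
    by (simp add: algebra_simps)
  finally have "[int (rep (a + int m * (b - a)))
      = int m * int (rep b) - (int m - 1) * int (rep a)] (mod int n)"
    using rep(2) cong_sym cong_trans by blast
  then have "Ln_index n m (rep a) (rep b) = rep (a + int m * (b - a))"
    unfolding Ln_index_def using rep(1) by (intro the1_equality Ln_index_ex1 assms(1)) simp
  moreover have "rep a \<noteq> rep b"
    using assms Residue_eq_iff[of n a b] by (simp add: Residue_def rep_def)
  ultimately show ?thesis
    by (simp add: Residue_def rep_def)
qed

lemma Ln_mult_E_right [simp]: "Ln_mult n m x E = x"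
  by (cases x) simp_all

lemma Ln_mult_self [simp]: "Ln_mult n m x x = E"
  by (cases x) simp_all

lemma not_moufang_Ln:
  assumes "n > 3" and "0 < m" and "gcd m n = 1" and "gcd (m - 1) n = 1"
  shows "\<not> moufang (Ln n m)"
proof
  assume moufang: "moufang (Ln n m)"
  have n: "0 < n" and not_1: "\<not> int n dvd 1" and not_3: "\<not> int n dvd 3"
    using \<open>n > 3\<close> by (auto dest: zdvd_imp_le)
  have "coprime (int (m - 1)) (int n)" and cop_m: "coprime (int n) (int m)"
    using assms(3,4) by (simp_all add: coprime_iff_gcd_eq_1 gcd.commute)
  moreover have "int (m - 1) = - (1 - int m)"
    using \<open>0 < m\<close> by simp
  ultimately have cop_1m: "coprime (int n) (1 - int m)"
    by (metis coprime_commute coprime_minus_right_iff)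
  have not_unit: "\<not> int n dvd u" if "coprime (int n) u" for u
    using that not_1 by (meson coprime_common_divisor dvd_refl)

  define x y where "x = Residue n 0" and "y = Residue n 1"
  note eq_iff = Residue_eq_iff[OF n]
  have carr: "x \<in> carrier (Ln n m)" "y \<in> carrier (Ln n m)" "E \<in> carrier (Ln n m)"
    unfolding x_def y_def by (auto intro: Residue_in_carrier[OF n]) (simp add: Ln_def)
  have mult: "monoid.mult (Ln n m) = Ln_mult n m"
    by (simp add: Ln_def)
  \<comment> \<open>All intermediate products are nonzero residues because they are units modulo \<open>n\<close>.\<close>
  have left: "Ln_mult n m x (Residue n u) = Residue n (int m * u)" if "coprime (int n) u" for u
    using Ln_mult_Residue[OF n, of 0 u m] not_unit[OF that] by (simp add: x_def)
  have right: "Ln_mult n m (Residue n u) x = Residue n ((1 - int m) * u)"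
    if "coprime (int n) u" for u
    using Ln_mult_Residue[OF n, of u 0 m] not_unit[OF that] by (simp add: x_def algebra_simps)
  have xy: "Ln_mult n m x y = Residue n (int m)"
    and yx: "Ln_mult n m y x = Residue n (1 - int m)"
    using left[of 1] right[of 1] by (simp_all add: y_def)
  have x_xy: "Ln_mult n m x (Ln_mult n m x y) = Residue n (int m * int m)"
    and xy_x: "Ln_mult n m (Ln_mult n m x y) x = Residue n ((1 - int m) * int m)"
    and x_yx: "Ln_mult n m x (Ln_mult n m y x) = Residue n (int m * (1 - int m))"
    and yx_x: "Ln_mult n m (Ln_mult n m y x) x = Residue n ((1 - int m) * (1 - int m))"
    unfolding xy yx using cop_m cop_1m by (simp_all add: left right)
  have x_yx_x: "Ln_mult n m (Ln_mult n m x (Ln_mult n m y x)) x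
      = Residue n ((1 - int m) * (int m * (1 - int m)))"
    unfolding x_yx using cop_m cop_1m by (simp add: right)

  have xy_carr: "Ln_mult n m x y \<in> carrier (Ln n m)"
    and yx_carr: "Ln_mult n m y x \<in> carrier (Ln n m)"
    unfolding xy yx by (rule Residue_in_carrier[OF n])+

  \<comment> \<open>Cases (ii) and (iii) end alike, because \<open>1 - m (1 - m) = (m + 1) (m - 2) + 3\<close>.\<close>
  have contradiction: False
    if "int n dvd (int m + 1) * (int m - 2)" and "int n dvd int m * (1 - int m) - 1"
  proof -
    have "int n dvd - ((int m + 1) * (int m - 2)) - (int m * (1 - int m) - 1)"
      using that dvd_diff dvd_minus_iff by blast
    also have "\<dots> = 3"
      by (simp add: algebra_simps)
    finally show False
      using not_3 by blast
  qed

  consider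
    (i) "\<forall>u\<in>carrier (Ln n m). \<forall>v\<in>carrier (Ln n m). \<forall>w\<in>carrier (Ln n m).
           Ln_mult n m (Ln_mult n m u v) (Ln_mult n m w u)
           = Ln_mult n m (Ln_mult n m u (Ln_mult n m v w)) u"
  | (ii) "\<forall>u\<in>carrier (Ln n m). \<forall>v\<in>carrier (Ln n m). \<forall>w\<in>carrier (Ln n m).
           Ln_mult n m (Ln_mult n m (Ln_mult n m u v) w) v
           = Ln_mult n m u (Ln_mult n m v (Ln_mult n m w v))"
  | (iii) "\<forall>u\<in>carrier (Ln n m). \<forall>v\<in>carrier (Ln n m). \<forall>w\<in>carrier (Ln n m).
           Ln_mult n m u (Ln_mult n m v (Ln_mult n m u w))
           = Ln_mult n m (Ln_mult n m (Ln_mult n m u v) u) w"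
    using moufang unfolding moufang_def mult by blast
  then show False
  proof cases
    case i
    \<comment> \<open>Putting \<open>z = y\<close> gives \<open>(x y) (y x) = e\<close>, which only equal factors satisfy.\<close>
    have "Ln_mult n m (Ln_mult n m x y) (Ln_mult n m y x) = E"
      using i[rule_format, of x y y] carr by simp
    then have "int n dvd int m - (1 - int m)"
      unfolding xy yx using Ln_mult_Residue[OF n]
      by (metis Residue_def loop_elem.distinct(1))
    then have comm: "int n dvd 2 * int m - 1"
      by simp
    \<comment> \<open>Putting \<open>z = x\<close> gives \<open>(x (y x)) x = x y\<close>.\<close>
    have "Residue n ((1 - int m) * (int m * (1 - int m))) = Residue n (int m)"
      using i[rule_format, of x y x] carr x_yx_x by (simp add: xy)
    then have "int n dvd (1 - int m) * (int m * (1 - int m)) - int m"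
      by (simp add: eq_iff)
    also have "\<dots> = int m * ((1 - int m) * (1 - int m) - 1)"
      by (simp add: algebra_simps)
    finally have "int n dvd (1 - int m) * (1 - int m) - 1"
      using cop_m coprime_dvd_mult_right_iff by blast
    \<comment> \<open>As \<open>2 m = 1\<close>, also \<open>4 (1 - m)\<^sup>2 = 1\<close>, and \<open>4 = 1\<close> follows.\<close>
    then have "int n dvd (2 * int m - 1) * (2 * int m - 3)
        - 4 * ((1 - int m) * (1 - int m) - 1)"
      using comm by (blast intro: dvd_diff dvd_mult dvd_mult2)
    also have "\<dots> = 3"
      by (simp add: algebra_simps)
    finally show False
      using not_3 by blast
  next
    case ii
    \<comment> \<open>Putting \<open>z = e\<close> gives \<open>(x y) y = x\<close>, and \<open>z = x y\<close> then gives \<open>y = x (y x)\<close>.\<close>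
    have cancel: "Ln_mult n m (Ln_mult n m x y) y = x" "Ln_mult n m (Ln_mult n m y x) x = y"
      using ii[rule_format, of x y E] ii[rule_format, of y x E] carr by simp_all
    have semisym: "Ln_mult n m x (Ln_mult n m y x) = y"
      using ii[rule_format, of x y "Ln_mult n m x y"] carr xy_carr by (simp add: cancel)
    have "int n dvd (1 - int m) * (1 - int m) - 1"
      using cancel(2) unfolding yx_x by (simp add: y_def eq_iff)
    also have "\<dots> = int m * (int m - 2)"
      by (simp add: algebra_simps)
    finally have "int n dvd int m - 2"
      using cop_m coprime_dvd_mult_right_iff by blast
    moreover have "int n dvd int m * (1 - int m) - 1"
      using semisym unfolding x_yx by (simp add: y_def eq_iff)
    ultimately show False
      using contradiction by simp
  next
    case iii
    \<comment> \<open>Putting \<open>y = e\<close> gives \<open>x (x z) = z\<close>, and \<open>y = x z\<close> then gives \<open>x = (z x) z\<close>.\<close>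
    have cancel: "Ln_mult n m x (Ln_mult n m x y) = y" "Ln_mult n m y (Ln_mult n m y x) = x"
      using iii[rule_format, of x E y] iii[rule_format, of y E x] carr by simp_all
    have semisym: "Ln_mult n m (Ln_mult n m x y) x = y"
      using iii[rule_format, of y "Ln_mult n m y x" x] carr yx_carr by (simp add: cancel)
    have "int n dvd int m * int m - 1"
      using cancel(1) unfolding x_xy by (simp add: y_def eq_iff)
    then have "int n dvd - (int m * int m - 1)"
      by (simp only: dvd_minus_iff)
    also have "\<dots> = (1 - int m) * (int m + 1)"
      by (simp add: algebra_simps)
    finally have "int n dvd int m + 1"
      using cop_1m coprime_dvd_mult_right_iff by blast
    moreover have "int n dvd int m * (1 - int m) - 1"
      using semisym unfolding xy_x by (simp add: y_def eq_iff mult.commute)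
    ultimately show False
      using contradiction by simp
  qed
qed

lemma moufang_neutrosophic_imp:
  assumes "moufang (neutrosophic L)"
  shows "moufang L"
proof -
  have pure: "Pure u \<in> carrier (neutrosophic L)" if "u \<in> carrier L" for u
    using that by (simp add: neutrosophic_def)
  have mult: "Pure u \<otimes>\<^bsub>neutrosophic L\<^esub> Pure v = Pure (u \<otimes>\<^bsub>L\<^esub> v)" for u v
    by (simp add: neutrosophic_def)
  show ?thesis
    using assms unfolding moufang_def
  proof (elim disj_forward, goal_cases)
    case 1
    show ?case
      by (intro ballI) (rule 1[rule_format, OF pure pure pure, unfolded mult neutro.inject])
  next
    case 2
    show ?case
      by (intro ballI) (rule 2[rule_format, OF pure pure pure, unfolded mult neutro.inject])
  next
    case 3
    show ?case
      by (intro ballI) (rule 3[rule_format, OF pure pure pure, unfolded mult neutro.inject])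
  qed
qed

theorem theorem4p1p10:
  fixes n :: nat
  assumes "n > 3" and "odd n"
  shows "\<forall>N \<in> neutrosophic_Ln_class n. \<not> moufang N"
proof
  fix N
  assume "N \<in> neutrosophic_Ln_class n"
  then obtain m where N: "N = neutrosophic (Ln n m)" and "0 < m" "gcd m n = 1" "gcd (m - 1) n = 1"
    unfolding neutrosophic_Ln_class_def mem_Collect_eq by (elim exE conjE)
  then have "\<not> moufang (Ln n m)"
    using \<open>n > 3\<close> by (intro not_moufang_Ln)
  then show "\<not> moufang N"
    unfolding N by (rule contrapos_nn) (rule moufang_neutrosophic_imp)
qed

end
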